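(* Let $n,k$ be integers with $0<k<n/2$ such that $k^2\equiv k\pmod n$ or $k^2\equiv -k\pmod n$. Then there exist a monoid $M$ which is an orthogroup and a subset $C\subseteq M$ such that $\mathrm{Cay}(M,C)$ has no loops and $G(n,k)$ is isomorphic to the underlying graph of $\mathrm{Cay}(M,C)$.
   Context: $G(n,k)$ ($0<k<n/2$) has vertices $u_0,\dots,u_{n-1},v_0,\dots,v_{n-1}$ and edges $u_iu_{i+1}$, $v_iv_{i+k}$, $u_iv_i$ (indices mod $n$). For a semigroup $S$ and $C\subseteq S$, $\mathrm{Cay}(S,C)$ is the directed multigraph with vertex set $S$ and one arc $(s,sc)$ for each $s\in S$, $c\in C$ (a loop when $sc=s$); its underlying graph is obtained by deleting loops, forgetting orientations and merging parallel edges. A semigroup is an orthogroup if it is a union of subgroups and its set of idempotents is a subsemigroup. *)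

theory Defs
  imports
    "HOL-Algebra.Group"
    "HOL-Number_Theory.Cong"
    "Graph_Theory.Digraph"
begin

record 'a ugraph =
  uverts :: "'a set"
  uedges :: "'a set set"

definition ugraph_iso :: "'a ugraph \<Rightarrow> 'b ugraph \<Rightarrow> bool" where
  "ugraph_iso G H \<longleftrightarrow>
     (\<exists>f. bij_betw f (uverts G) (uverts H) \<and>
          (\<forall>x\<in>uverts G. \<forall>y\<in>uverts G. {x, y} \<in> uedges G \<longleftrightarrow> {f x, f y} \<in> uedges H))"

text \<open>\<open>Outer i\<close> is $u_i$ and \<open>Inner i\<close> is $v_i$.\<close>

datatype gp_vertex = Outer nat | Inner nat

definition gen_petersen :: "nat \<Rightarrow> nat \<Rightarrow> gp_vertex ugraph" where
  "gen_petersen n k = \<lparr>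
     uverts = Outer ` {..<n} \<union> Inner ` {..<n},
     uedges = {{Outer i, Outer ((i + 1) mod n)} | i. i < n}
            \<union> {{Inner i, Inner ((i + k) mod n)} | i. i < n}
            \<union> {{Outer i, Inner i} | i. i < n} \<rparr>"

text \<open>HOL-Algebra has no carrier-based semigroups. The type of monoid records is used for
  them too; the next three definitions do not depend on the field \<open>one\<close>.\<close>

definition is_semigroup :: "'a monoid \<Rightarrow> bool" where
  "is_semigroup S \<longleftrightarrow>
     (\<forall>x\<in>carrier S. \<forall>y\<in>carrier S. x \<otimes>\<^bsub>S\<^esub> y \<in> carrier S) \<and>
     (\<forall>x\<in>carrier S. \<forall>y\<in>carrier S. \<forall>z\<in>carrier S.
        (x \<otimes>\<^bsub>S\<^esub> y) \<otimes>\<^bsub>S\<^esub> z = x \<otimes>\<^bsub>S\<^esub> (y \<otimes>\<^bsub>S\<^esub> z))"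

text \<open>The identity \<open>e\<close> of a subgroup of a semigroup may be any idempotent, even if
  the semigroup is a monoid; hence HOL-Algebra's \<open>subgroup\<close> does not apply.\<close>

definition is_subgroup_of_semigroup :: "'a set \<Rightarrow> 'a monoid \<Rightarrow> bool" where
  "is_subgroup_of_semigroup H S \<longleftrightarrow>
     H \<subseteq> carrier S \<and> (\<exists>e. group (S\<lparr>carrier := H, one := e\<rparr>))"

definition idempotents :: "'a monoid \<Rightarrow> 'a set" where
  "idempotents S = {e \<in> carrier S. e \<otimes>\<^bsub>S\<^esub> e = e}"

definition orthogroup :: "'a monoid \<Rightarrow> bool" where
  "orthogroup S \<longleftrightarrow>
     is_semigroup S \<and>
     carrier S = \<Union>{H. is_subgroup_of_semigroup H S} \<and>
     (\<forall>e\<in>idempotents S. \<forall>f\<in>idempotents S. e \<otimes>\<^bsub>S\<^esub> f \<in> idempotents S)"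

definition Cay :: "'a monoid \<Rightarrow> 'a set \<Rightarrow> ('a, 'a \<times> 'a) pre_digraph" where
  "Cay S C = \<lparr>
     verts = carrier S,
     arcs = carrier S \<times> C,
     tail = fst,
     head = (\<lambda>(s, c). s \<otimes>\<^bsub>S\<^esub> c) \<rparr>"

definition underlying_graph :: "('a, 'b) pre_digraph \<Rightarrow> 'a ugraph" where
  "underlying_graph D = \<lparr>
     uverts = verts D,
     uedges = {{tail D a, head D a} | a. a \<in> arcs D \<and> tail D a \<noteq> head D a} \<rparr>"

end

theory Submission
  imports Defs
begin

text \<open>Replacing \<open>k\<close> by \<open>c = \<plusminus>k\<close> one may assume \<open>c\<^sup>2 \<equiv> c\<close> modulo \<open>n\<close>. Let the outer vertices
  form the group \<open>\<int>\<^sub>n\<close>, and put \<open>u\<^sub>i v\<^sub>j = v\<^bsub>i+j\<^esub>\<close>, \<open>v\<^sub>i u\<^sub>j = v\<^bsub>i+cj\<^esub>\<close> and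
  \<open>v\<^sub>i v\<^sub>j = v\<^bsub>i+c(j+1)\<^esub>\<close>. Associativity is exactly \<open>c\<^sup>2 \<equiv> c\<close>. The connection set
  \<open>{u\<^sub>1, v\<^sub>0}\<close> gives the arcs from \<open>u\<^sub>i\<close> to \<open>u\<^bsub>i+1\<^esub>\<close> and \<open>v\<^sub>i\<close>, and two arcs from \<open>v\<^sub>i\<close> to
  \<open>v\<^bsub>i+c\<^esub>\<close>. The subgroup containing \<open>v\<^sub>i\<close> is \<open>{v\<^bsub>i+ca\<^esub> | a \<in> \<int>}\<close>, with identity
  \<open>a = -(i+1)\<close>.\<close>

section \<open>Coding of the vertices and multiplication by indices\<close>

locale gp_orthomonoid =
  fixes n :: nat and c :: int
  assumes n_pos: "0 < n"
    and c_idem: "[c * c = c] (mod int n)"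
begin

text \<open>Indices are arbitrary integers, reduced only here, so that negative \<open>c\<close> and
  inverses need no case distinction. The two vertex classes occupy the blocks below \<open>n\<close>
  and from \<open>n\<close> to \<open>2 * n - 1\<close>.\<close>

definition outer :: "int \<Rightarrow> nat" where
  "outer i = nat (i mod int n)"

definition inner :: "int \<Rightarrow> nat" where
  "inner i = n + nat (i mod int n)"

text \<open>As \<open>inner\<close> is periodic, \<open>inner (int x)\<close> is \<open>x\<close> itself when \<open>n \<le> x < 2 * n\<close>.\<close>

definition gp_mult :: "nat \<Rightarrow> nat \<Rightarrow> nat" where
  "gp_mult x y =
     (if x < n then if y < n then outer (int x + int y) else inner (int x + int y)
      else inner (int x + c * (if y < n then int y else int y + 1)))"

definition gp_monoid :: "nat monoid" where
  "gp_monoid = \<lparr>carrier = {..<2 * n}, monoid.mult = gp_mult, one = 0\<rparr>"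

lemma outer_less: "outer i < n"
  using n_pos unfolding outer_def by (simp add: nat_less_iff)

lemma inner_ge: "\<not> inner i < n"
  unfolding inner_def by simp

lemma inner_less: "inner i < 2 * n"
  using n_pos unfolding inner_def by (simp add: nat_less_iff)

lemma outer_eq_iff: "outer i = outer j \<longleftrightarrow> [i = j] (mod int n)"
  using n_pos unfolding outer_def cong_def by (simp add: eq_nat_nat_iff)

lemma inner_eq_iff: "inner i = inner j \<longleftrightarrow> [i = j] (mod int n)"
  using n_pos unfolding inner_def cong_def by (simp add: eq_nat_nat_iff)

lemma outer_neq_inner: "outer i \<noteq> inner j"
  using outer_less inner_ge by metis

lemma int_outer_cong: "[int (outer i) = i] (mod int n)"
  using n_pos unfolding outer_def by simp

lemma int_inner_cong: "[int (inner i) = i] (mod int n)"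
  using n_pos unfolding inner_def cong_def by simp

lemma outer_of_nat: "x < n \<Longrightarrow> outer (int x) = x"
  unfolding outer_def by simp

lemma inner_of_nat:
  assumes "n \<le> x" "x < 2 * n"
  shows "inner (int x) = x"
proof -
  have "x mod n = x - n"
    using assms by (simp add: mod_if)
  then show ?thesis
    using assms unfolding inner_def by (simp flip: zmod_int)
qed

lemma carrier_eq: "carrier gp_monoid = range outer \<union> range inner"
proof
  show "carrier gp_monoid \<subseteq> range outer \<union> range inner"
    using outer_of_nat inner_of_nat unfolding gp_monoid_def
    by (auto, metis leI mult_2 rangeI)
  show "range outer \<union> range inner \<subseteq> carrier gp_monoid"
    using inner_less less_le_trans[OF outer_less, of "2 * n"] unfolding gp_monoid_def
    by auto
qed

lemma carrierE:
  assumes "x \<in> carrier gp_monoid"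
  obtains i where "x = outer i" | i where "x = inner i"
  using assms unfolding carrier_eq by auto

text \<open>A code is congruent to its index modulo \<open>n\<close>, and every product depends on
  indices only up to congruence. With this rule and the next three, products are computed on integer
  indices without unfolding \<open>gp_mult\<close>.\<close>

lemma outer_outer: "outer i \<otimes>\<^bsub>gp_monoid\<^esub> outer j = outer (i + j)"
  unfolding gp_monoid_def gp_mult_def
  by (simp add: outer_less outer_eq_iff cong_add int_outer_cong)

lemma outer_inner: "outer i \<otimes>\<^bsub>gp_monoid\<^esub> inner j = inner (i + j)"
  unfolding gp_monoid_def gp_mult_def
  by (simp add: outer_less inner_ge inner_eq_iff cong_add int_outer_cong int_inner_cong)

lemma inner_outer: "inner i \<otimes>\<^bsub>gp_monoid\<^esub> outer j = inner (i + c * j)"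
  unfolding gp_monoid_def gp_mult_def
  by (simp add: outer_less inner_ge inner_eq_iff cong_add cong_scalar_left
      int_outer_cong int_inner_cong)

lemma inner_inner: "inner i \<otimes>\<^bsub>gp_monoid\<^esub> inner j = inner (i + c * (j + 1))"
  unfolding gp_monoid_def gp_mult_def
  by (simp add: inner_ge inner_eq_iff cong_add cong_scalar_left int_inner_cong)

lemmas mult_rules = outer_outer outer_inner inner_outer inner_inner

lemma c_idem_cong: "[i + c * j = i + c * (c * j)] (mod int n)"
  using cong_add[OF cong_refl cong_scalar_right[OF cong_sym[OF c_idem]]]
  by (simp add: mult.assoc)

text \<open>The form in which idempotence of \<open>c\<close> enters both associativity and the
  subgroup structure.\<close>

lemma inner_c_idem: "inner (i + c * (c * j)) = inner (i + c * j)"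
  using c_idem_cong inner_eq_iff by metis

lemma one_eq: "\<one>\<^bsub>gp_monoid\<^esub> = outer 0"
  unfolding gp_monoid_def outer_def by simp

section \<open>Monoid laws\<close>

lemma mult_closed:
  assumes "x \<in> carrier gp_monoid" "y \<in> carrier gp_monoid"
  shows "x \<otimes>\<^bsub>gp_monoid\<^esub> y \<in> carrier gp_monoid"
  using assms by (elim carrierE) (auto simp: mult_rules carrier_eq)

lemma mult_assoc:
  assumes "x \<in> carrier gp_monoid" "y \<in> carrier gp_monoid" "z \<in> carrier gp_monoid"
  shows "(x \<otimes>\<^bsub>gp_monoid\<^esub> y) \<otimes>\<^bsub>gp_monoid\<^esub> z = x \<otimes>\<^bsub>gp_monoid\<^esub> (y \<otimes>\<^bsub>gp_monoid\<^esub> z)"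
proof -
  \<comment> \<open>A nested factor \<open>c\<close> arises only when the first two factors are both
    inner. Then \<open>m = 1\<close> is the shift in \<open>inner_inner\<close>.\<close>
  have absorb: "inner (i + c * (j + c * l + m)) = inner (i + c * (j + l + m))" for i j l m
    using inner_c_idem[of "i + c * j + c * m" l] by (simp add: algebra_simps)
  show ?thesis
    using assms absorb[where m = 0] absorb[where m = 1]
    by (elim carrierE) (simp_all add: mult_rules, simp_all add: algebra_simps)
qed

lemma monoid_gp_monoid: "monoid gp_monoid"
proof (rule monoidI)
  show "\<one>\<^bsub>gp_monoid\<^esub> \<in> carrier gp_monoid"
    by (simp add: one_eq carrier_eq)
  show "\<one>\<^bsub>gp_monoid\<^esub> \<otimes>\<^bsub>gp_monoid\<^esub> x = x" "x \<otimes>\<^bsub>gp_monoid\<^esub> \<one>\<^bsub>gp_monoid\<^esub> = x"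
    if "x \<in> carrier gp_monoid" for x
    using that by (auto elim!: carrierE simp: one_eq mult_rules)
qed (simp_all add: mult_closed mult_assoc)

section \<open>Subgroups and idempotents\<close>

lemma subgroup_outer: "is_subgroup_of_semigroup (range outer) gp_monoid"
proof -
  have "group (gp_monoid\<lparr>carrier := range outer, one := outer 0\<rparr>)"
  proof (rule groupI, goal_cases)
    case (5 x)
    then obtain i where "x = outer i"
      by auto
    then show ?case
      by (intro bexI[of _ "outer (- i)"]) (simp_all add: mult_rules)
  qed (clarsimp simp: mult_rules add.assoc)+
  then show ?thesis
    unfolding is_subgroup_of_semigroup_def carrier_eq by blast
qed

text \<open>In the parameter \<open>a\<close> the product becomes \<open>a + b + i + 1\<close>. This
  is addition of integers transported along a translation by \<open>i + 1\<close>, so the set is a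
  homomorphic image of a group.\<close>

lemma subgroup_inner:
  "is_subgroup_of_semigroup (range (\<lambda>a. inner (i + c * a))) gp_monoid"
proof -
  have mult: "inner (i + c * a) \<otimes>\<^bsub>gp_monoid\<^esub> inner (i + c * b) =
      inner (i + c * (a + b + i + 1))" for a b
    using inner_c_idem[of "i + c * a + c * (i + 1)" b]
    by (simp add: mult_rules algebra_simps)
  let ?H = "range (\<lambda>a. inner (i + c * a))"
  have "group (gp_monoid\<lparr>carrier := ?H, one := inner (i + c * (- (i + 1)))\<rparr>)"
  proof (rule groupI, goal_cases)
    case (1 x y)
    then show ?case
      by (auto simp: mult)
  next
    case 2
    show ?case
      by simp
  next
    case (3 x y z)
    then show ?case
      by (auto simp: carrier_eq intro!: mult_assoc)
  next
    case (4 x)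
    then obtain a where "x = inner (i + c * a)"
      by auto
    then show ?case
      using mult[of "- (i + 1)" a] by simp
  next
    case (5 x)
    then obtain a where x: "x = inner (i + c * a)"
      by auto
    \<comment> \<open>The inverse parameter: the solution of
      \<open>b + a + i + 1 = - (i + 1)\<close>.\<close>
    define b where "b = - a - 2 * (i + 1)"
    have "b + a + i + 1 = - (i + 1)"
      by (simp add: b_def)
    then have "inner (i + c * b) \<otimes>\<^bsub>gp_monoid\<^esub> x = inner (i + c * (- (i + 1)))"
      using mult[of b a] x by (simp only:)
    then show ?case
      by auto
  qed
  then show ?thesis
    unfolding is_subgroup_of_semigroup_def carrier_eq by blast
qed

lemma orthogroup_gp_monoid: "orthogroup gp_monoid"
  unfolding orthogroup_def
proof (intro conjI ballI)
  show "is_semigroup gp_monoid"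
    unfolding is_semigroup_def using mult_closed mult_assoc by blast
  show "carrier gp_monoid = \<Union>{H. is_subgroup_of_semigroup H gp_monoid}"
  proof
    show "carrier gp_monoid \<subseteq> \<Union>{H. is_subgroup_of_semigroup H gp_monoid}"
    proof
      fix x
      assume "x \<in> carrier gp_monoid"
      then show "x \<in> \<Union>{H. is_subgroup_of_semigroup H gp_monoid}"
      proof (cases rule: carrierE)
        case (1 i)
        then show ?thesis
          using subgroup_outer by blast
      next
        case (2 i)
        then have "x \<in> range (\<lambda>a. inner (i + c * a))"
          by (intro range_eqI[of _ _ 0]) simp
        then show ?thesis
          using subgroup_inner by blast
      qed
    qed
  qed (auto simp: is_subgroup_of_semigroup_def)
  fix e f
  assume "e \<in> idempotents gp_monoid" "f \<in> idempotents gp_monoid"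
  then have carrier: "e \<in> carrier gp_monoid" "f \<in> carrier gp_monoid"
    and idem: "e \<otimes>\<^bsub>gp_monoid\<^esub> e = e" "f \<otimes>\<^bsub>gp_monoid\<^esub> f = f"
    by (auto simp: idempotents_def)
  \<comment> \<open>Besides the identity, the idempotents are the \<open>inner i\<close> with \<open>c * (i + 1) \<equiv> 0\<close>,
    and they form a left zero band.\<close>
  have outer_idem: "outer i = outer 0" if "outer i \<otimes>\<^bsub>gp_monoid\<^esub> outer i = outer i" for i
    using that unfolding outer_outer outer_eq_iff cong_add_lcancel_0 .
  have left_zero: "inner i \<otimes>\<^bsub>gp_monoid\<^esub> inner j = inner i"
    if "inner j \<otimes>\<^bsub>gp_monoid\<^esub> inner j = inner j" for i j
    using that by (simp add: mult_rules inner_eq_iff cong_add_lcancel_0)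
  have unit: "outer 0 \<otimes>\<^bsub>gp_monoid\<^esub> x = x" "x \<otimes>\<^bsub>gp_monoid\<^esub> outer 0 = x"
    if "x \<in> carrier gp_monoid" for x
    using monoid.l_one[OF monoid_gp_monoid that] monoid.r_one[OF monoid_gp_monoid that]
    by (simp_all add: one_eq)
  have "e \<otimes>\<^bsub>gp_monoid\<^esub> f = e \<or> e \<otimes>\<^bsub>gp_monoid\<^esub> f = f"
    using carrier idem by (elim carrierE) (metis outer_idem left_zero unit carrier)+
  then show "e \<otimes>\<^bsub>gp_monoid\<^esub> f \<in> idempotents gp_monoid"
    using carrier idem by (auto simp: idempotents_def)
qed

section \<open>The Cayley graph and its edges\<close>

definition connection_set :: "nat set" where
  "connection_set = {outer 1, inner 0}"

text \<open>From \<open>outer i\<close> one arc advances the index by 1 and the other leaves the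
  outer block; from \<open>inner i\<close> both arcs advance by \<open>c\<close>. A loop would force
  \<open>n\<close> to divide 1 or \<open>c\<close>.\<close>

lemma loopfree_Cay:
  assumes "1 < n" "\<not> int n dvd c"
  shows "loopfree_digraph (Cay gp_monoid connection_set)"
proof
  fix a
  assume a: "a \<in> arcs (Cay gp_monoid connection_set)"
  then show "tail (Cay gp_monoid connection_set) a \<in> verts (Cay gp_monoid connection_set)"
    "head (Cay gp_monoid connection_set) a \<in> verts (Cay gp_monoid connection_set)"
    by (auto simp: Cay_def connection_set_def carrier_eq mult_rules)
  show "tail (Cay gp_monoid connection_set) a \<noteq> head (Cay gp_monoid connection_set) a"
    using a assms
    by (auto simp: Cay_def connection_set_def mult_rules outer_eq_iff inner_eq_iff
        outer_neq_inner cong_sym_eq[of i "i + _" for i] cong_add_lcancel_0 cong_0_iff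
        elim!: carrierE)
qed

lemma uedges_underlying_Cay:
  assumes "1 < n" "\<not> int n dvd c"
  shows "uedges (underlying_graph (Cay gp_monoid connection_set)) =
    range (\<lambda>i. {outer i, outer (i + 1)}) \<union> range (\<lambda>i. {inner i, inner (i + c)})
    \<union> range (\<lambda>i. {outer i, inner i})"
proof -
  let ?D = "Cay gp_monoid connection_set"
  interpret loopfree_digraph ?D
    using assms by (rule loopfree_Cay)
  \<comment> \<open>Without loops, the condition that tail and head differ holds for every
    arc.\<close>
  have "uedges (underlying_graph ?D) = (\<lambda>a. {tail ?D a, head ?D a}) ` arcs ?D"
    using no_loops by (auto simp: underlying_graph_def)
  also have "\<dots> = (\<Union>s\<in>carrier gp_monoid.
      {{s, s \<otimes>\<^bsub>gp_monoid\<^esub> outer 1}, {s, s \<otimes>\<^bsub>gp_monoid\<^esub> inner 0}})"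
    by (auto simp: Cay_def connection_set_def image_iff)
  also have "\<dots> = range (\<lambda>i. {outer i, outer (i + 1)}) \<union> range (\<lambda>i. {inner i, inner (i + c)})
    \<union> range (\<lambda>i. {outer i, inner i})"
    by (auto simp: carrier_eq mult_rules)
  finally show ?thesis .
qed

section \<open>Isomorphism with the generalized Petersen graph\<close>

definition gp_embed :: "gp_vertex \<Rightarrow> nat" where
  "gp_embed v = (case v of Outer i \<Rightarrow> outer (int i) | Inner i \<Rightarrow> inner (int i))"

text \<open>Connects families over all integers, as on the Cayley side, with families over
  \<open>i < n\<close>, as in \<open>gen_petersen\<close>.\<close>

lemma range_periodic:
  assumes "\<And>i :: int. g (i mod int n) = g i"
  shows "range g = {g (int i) | i. i < n}"
proof -
  have "\<exists>j. g i = g (int j) \<and> j < n" for i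
    using assms[of i] n_pos
    by (intro exI[of _ "nat (i mod int n)"]) (simp add: nat_less_iff)
  then show ?thesis
    by blast
qed

lemma outer_mod: "outer (i mod int n) = outer i" "outer (i mod int n + j) = outer (i + j)"
  by (simp_all add: outer_def mod_simps)

lemma inner_mod: "inner (i mod int n) = inner i" "inner (i mod int n + j) = inner (i + j)"
  by (simp_all add: inner_def mod_simps)

lemma image_uedges_gen_petersen:
  "(`) gp_embed ` uedges (gen_petersen n k) =
    range (\<lambda>i. {outer i, outer (i + 1)}) \<union> range (\<lambda>i. {inner i, inner (i + int k)})
    \<union> range (\<lambda>i. {outer i, inner i})"
proof -
  have "(`) gp_embed ` uedges (gen_petersen n k) =
    {{outer (int i), outer (int i + 1)} | i. i < n}
    \<union> {{inner (int i), inner (int i + int k)} | i. i < n}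
    \<union> {{outer (int i), inner (int i)} | i. i < n}"
    unfolding gen_petersen_def ugraph.simps image_Un setcompr_eq_image image_image
    by (simp add: gp_embed_def zmod_int outer_mod inner_mod add.commute)
  then show ?thesis
    by (simp add: range_periodic outer_mod inner_mod)
qed

lemma bij_betw_gp_embed:
  "bij_betw gp_embed (uverts (gen_petersen n k)) (uverts (underlying_graph (Cay gp_monoid C)))"
proof -
  have "inj_on gp_embed (uverts (gen_petersen n k))"
    by (auto simp: inj_on_def gen_petersen_def gp_embed_def outer_neq_inner
        outer_neq_inner[symmetric] outer_eq_iff inner_eq_iff cong_def)
  moreover have "gp_embed ` uverts (gen_petersen n k) =
      {outer (int i) | i. i < n} \<union> {inner (int i) | i. i < n}"
    by (auto simp: gen_petersen_def gp_embed_def image_Un image_image)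
  then have "gp_embed ` uverts (gen_petersen n k) = uverts (underlying_graph (Cay gp_monoid C))"
    using range_periodic[of outer] range_periodic[of inner]
    by (simp add: underlying_graph_def Cay_def carrier_eq outer_mod inner_mod)
  ultimately show ?thesis
    unfolding bij_betw_def by blast
qed

end

text \<open>Since \<open>f\<close> is injective on vertices, its image map is injective on sets of
  vertices, so the image of a non-edge cannot coincide with the image of an edge.\<close>

lemma ugraph_isoI:
  assumes "bij_betw f (uverts G) (uverts H)"
    and "uedges G \<subseteq> Pow (uverts G)"
    and "(`) f ` uedges G = uedges H"
  shows "ugraph_iso G H"
  unfolding ugraph_iso_def
proof (intro exI[of _ f] conjI ballI)
  fix x y
  assume "x \<in> uverts G" "y \<in> uverts G"
  moreover have "inj_on ((`) f) (Pow (uverts G))"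
    using assms(1) by (intro inj_on_image_Pow) (rule bij_betw_imp_inj_on)
  ultimately have "f ` {x, y} \<in> (`) f ` uedges G \<longleftrightarrow> {x, y} \<in> uedges G"
    using assms(2) by (intro inj_on_image_mem_iff) auto
  then show "{x, y} \<in> uedges G \<longleftrightarrow> {f x, f y} \<in> uedges H"
    using assms(3) by simp
qed (rule assms(1))

lemma uedges_gen_petersen_subset: "uedges (gen_petersen n k) \<subseteq> Pow (uverts (gen_petersen n k))"
  by (auto simp: gen_petersen_def)

theorem theorem3p11:
  fixes n k :: nat
  assumes "0 < k" and "2 * k < n"
    and "[(int k)\<^sup>2 = int k] (mod int n) \<or> [(int k)\<^sup>2 = - int k] (mod int n)"
  shows "\<exists>(M :: nat monoid) C.
           monoid M \<and> orthogroup M \<and> C \<subseteq> carrier M \<and>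
           loopfree_digraph (Cay M C) \<and>
           ugraph_iso (gen_petersen n k) (underlying_graph (Cay M C))"
proof -
  \<comment> \<open>If the square of \<open>k\<close> is congruent to \<open>- k\<close>, then
    \<open>- k\<close> is idempotent, having the same square.\<close>
  obtain c where c: "c = int k \<or> c = - int k" and idem: "[c * c = c] (mod int n)"
  proof (cases "[(int k)\<^sup>2 = int k] (mod int n)")
    case True
    then show ?thesis
      using that[of "int k"] by (simp add: power2_eq_square)
  next
    case False
    then show ?thesis
      using that[of "- int k"] assms(3) by (simp add: power2_eq_square)
  qed
  interpret gp_orthomonoid n c
    using assms idem by unfold_locales auto
  have n: "1 < n"
    using assms by simp
  have "\<not> int n dvd int k"
    using assms by (auto dest: dvd_imp_le)
  then have ndvd: "\<not> int n dvd c"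
    using c by auto
  \<comment> \<open>The sign of \<open>c\<close> does not affect the undirected inner edges: the
    edge at \<open>i\<close> with step \<open>- k\<close> is the edge at \<open>i - k\<close> with
    step \<open>k\<close>.\<close>
  have "(\<lambda>i. {inner i, inner (i - int k)}) = (\<lambda>i. {inner i, inner (i + int k)}) \<circ> (\<lambda>i. i - int k)"
    by (auto simp: fun_eq_iff)
  then have "range (\<lambda>i. {inner i, inner (i - int k)}) = range (\<lambda>i. {inner i, inner (i + int k)})"
    by (simp only: image_comp[symmetric] surj_diff_right)
  then have "range (\<lambda>i. {inner i, inner (i + c)}) = range (\<lambda>i. {inner i, inner (i + int k)})"
    using c by (elim disjE) simp_all
  then have "(`) gp_embed ` uedges (gen_petersen n k) =
      uedges (underlying_graph (Cay gp_monoid connection_set))"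
    by (simp add: image_uedges_gen_petersen uedges_underlying_Cay[OF n ndvd])
  then have "ugraph_iso (gen_petersen n k) (underlying_graph (Cay gp_monoid connection_set))"
    by (rule ugraph_isoI[OF bij_betw_gp_embed uedges_gen_petersen_subset])
  moreover have "connection_set \<subseteq> carrier gp_monoid"
    by (simp add: connection_set_def carrier_eq)
  ultimately show ?thesis
    using monoid_gp_monoid orthogroup_gp_monoid loopfree_Cay[OF n ndvd] by blast
qed

end
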